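(* Let $f(x)=x^5+a_1x^4+a_2x^3+a_3x^2+a_4x+a_5\in H_5$, and put $$u=\frac{a_3}{a_1a_2},\qquad v=\frac{a_2a_5}{a_3a_4},\qquad w=\frac{a_1a_4}{a_2a_3}.$$ Then $$\mathcal P(f)=\{\,p>0: f^{[p]}\in H_5\,\}=(p_*(f),\infty),$$ where $p_*(f)\in(0,1)$ is the unique zero in $(0,\infty)$ of the function $$h_f(p)=\ln(1-u^p)+\ln(1-v^p)-2\ln\bigl(1-(uv)^p\bigr)-p\ln w,\qquad p>0.$$ Moreover, $p_*(f)$ is the unique solution $p$ in $(0,1)$ of the equation $$(1-u^p)(1-v^p)=w^p\bigl(1-(uv)^p\bigr)^2.$$
   Context: A real polynomial is called (Hurwitz-) stable if all its zeros lie in the open left half of the complex plane. $H_5$ denotes the family of all monic stable real polynomials of degree five with positive coefficients. For $f(x)=x^5+a_1x^4+a_2x^3+a_3x^2+a_4x+a_5$ with positive coefficients and $p>0$, the $p$-th Hadamard power of $f$ is $f^{[p]}(x)=x^5+a_1^px^4+a_2^px^3+a_3^px^2+a_4^px+a_5^p$. For $f\in H_5$ the parameters $u,v,w$ all lie in $(0,1)$ (a known consequence of the positivity of the principal minors of the Hurwitz matrix), so $h_f(p)$ is well defined for every $p>0$. *)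

theory Defs
  imports "HOL-Analysis.Analysis" "HOL-Computational_Algebra.Polynomial"
begin

definition hurwitz_stable :: "real poly \<Rightarrow> bool" where
  "hurwitz_stable f \<longleftrightarrow> (\<forall>z::complex. poly (map_poly complex_of_real f) z = 0 \<longrightarrow> Re z < 0)"

definition H5 :: "real poly set" where
  "H5 = {f. degree f = 5 \<and> lead_coeff f = 1 \<and> (\<forall>i\<le>5. coeff f i > 0) \<and> hurwitz_stable f}"

(* Since 0 powr p = 0 and 1 powr p = 1, this preserves the degree and monicity;
   it is the intended operation only on polynomials with nonnegative coefficients. *)
definition hadamard_power :: "real poly \<Rightarrow> real \<Rightarrow> real poly" where
  "hadamard_power f p = map_poly (\<lambda>c. c powr p) f"

definition stable_powers :: "real poly \<Rightarrow> real set" where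
  "stable_powers f = {p. p > 0 \<and> hadamard_power f p \<in> H5}"

definition h_fun :: "real \<Rightarrow> real \<Rightarrow> real \<Rightarrow> real \<Rightarrow> real" where
  "h_fun u v w p =
     ln (1 - u powr p) + ln (1 - v powr p) - 2 * ln (1 - (u * v) powr p) - p * ln w"

end

theory Submission
  imports Defs "HOL-Computational_Algebra.Fundamental_Theorem_Algebra"
begin

text \<open>
  For a quintic with positive coefficients, stability is equivalent to positivity of the second and
  fourth Hurwitz minors. Dividing these minors by products of coefficients turns the criterion into
  \<open>u < 1\<close>, \<open>v < 1\<close> and \<open>w * (1 - u * v)\<^sup>2 < (1 - u) * (1 - v)\<close> (lemma \<open>H5_iff_ratios\<close>).
  A Hadamard power replaces \<open>u, v, w\<close> by their \<open>p\<close>-th powers, so, once \<open>u, v, w\<close> lie in \<open>(0,1)\<close>,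
  the logarithm of the last inequality says that the \<open>p\<close>-th Hadamard power is stable if and only if
  \<open>h_fun u v w p > 0\<close>.

  The function \<open>h_fun u v w\<close> is strictly increasing. It is the sum of the increasing term \<open>- p * ln w\<close>
  and of the logarithms of the two quotients \<open>(1 - u\<^sup>p) / (1 - (u v)\<^sup>p)\<close> and
  \<open>(1 - v\<^sup>p) / (1 - (u v)\<^sup>p)\<close>; each quotient is nondecreasing in \<open>p\<close> because the slope of a chord
  of the convex function \<open>x \<mapsto> x\<^sup>s\<close> (\<open>s \<ge> 1\<close>) ending at \<open>1\<close> grows with its left end
  (lemma \<open>ln_one_minus_powr_diff_mono\<close>). Near \<open>p = 0\<close> the function is negative, as
  its limit there is at most \<open>- ln 4\<close> by the arithmetic-geometric mean inequality
  (lemma \<open>h_fun_neg_near_zero\<close>), and at \<open>p = 1\<close> it is positive because \<open>f\<close> itself is stable. Hence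
  it has exactly one zero, which lies in \<open>(0,1)\<close> and is the threshold.

  The Hurwitz criterion is proved by factoring the quintic over the reals as
  \<open>(x + r) (x\<^sup>2 + b x + c) (x\<^sup>2 + d x + e)\<close>: it is stable exactly when all five
  parameters are positive, and the fourth minor is, by Orlando's formula, the product of the sums of
  two roots, which the parameters express explicitly (lemma \<open>hurwitz_criterion_quintic\<close>).
\<close>

section \<open>Real factorization of quintics\<close>

lemma odd_degree_has_real_root:
  fixes p :: "real poly"
  assumes "odd (degree p)" and "lead_coeff p > 0"
  shows "\<exists>x. poly p x = 0"
proof -
  obtain m where m: "\<forall>x\<ge>m. poly p x \<ge> lead_coeff p"
    using poly_pinfty_gt_lc[OF assms(2)] by blast
  define q where "q = - (p \<circ>\<^sub>p [:0, -1:])"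
  have lc: "lead_coeff q = lead_coeff p"
    using assms(1) by (simp add: q_def lead_coeff_comp)
  then obtain n where n: "\<forall>x\<ge>n. poly q x \<ge> lead_coeff q"
    using poly_pinfty_gt_lc[of q] assms(2) by auto
  define M where "M = max 1 (max m n)"
  have M: "M > 0" "m \<le> M" "n \<le> M" by (auto simp: M_def)
  have "poly p M > 0" using m M assms(2) by (blast intro: less_le_trans)
  moreover have "poly q M > 0" using n M lc assms(2) by (metis less_le_trans)
  then have "poly p (- M) < 0" by (simp add: q_def poly_pcompose)
  ultimately show ?thesis using poly_IVT_pos[of "-M" M p] M by auto
qed

text \<open>
  A complex root \<open>z\<close> that is not real gives the factor \<open>x\<^sup>2 - 2 Re z x + |z|\<^sup>2\<close>, because the remainder
  of the division is a real linear polynomial that vanishes at \<open>z\<close>. If the root is real, the cubic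
  cofactor has a real root as well, and these two roots form one of the quadratic factors.
\<close>

lemma real_quartic_quadratic_factors:
  fixes m n k l :: real
  obtains b c d e where "[:l, k, n, m, 1:] = [:c, b, 1:] * [:e, d, 1:]"
proof -
  have "\<exists>b c d e. m = b + d \<and> n = c + b * d + e \<and> k = b * e + c * d \<and> l = c * e"
  proof -
    have "\<not> constant (poly [:complex_of_real l, k, n, m, 1:])"
      by (simp add: constant_degree)
    then obtain z where "poly [:complex_of_real l, k, n, m, 1:] z = 0"
      using fundamental_theorem_of_algebra by blast
    then have z: "z ^ 4 + m * z ^ 3 + n * z ^ 2 + k * z + l = 0"
      by (simp add: algebra_simps power_numeral_reduce)
    show ?thesis
    proof (cases "Im z = 0")
      case True
      define x where "x = Re z"
      have zx: "z = of_real x" using True by (simp add: x_def complex_eq_iff)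
      have "complex_of_real (x ^ 4 + m * x ^ 3 + n * x ^ 2 + k * x + l) = 0"
        using z zx by simp
      then have x: "x ^ 4 + m * x ^ 3 + n * x ^ 2 + k * x + l = 0"
        by (simp only: of_real_eq_0_iff)
      \<comment> \<open>\<open>1, \<alpha>, \<beta>, \<gamma>\<close> are the Horner coefficients of the cubic cofactor of \<open>X - x\<close>; after division
        by \<open>X - y\<close> what remains is \<open>X\<^sup>2 + (\<alpha> + y) X + (\<beta> + (\<alpha> + y) y)\<close>.\<close>
      define \<alpha> where "\<alpha> = m + x"
      define \<beta> where "\<beta> = n + \<alpha> * x"
      define \<gamma> where "\<gamma> = k + \<beta> * x"
      obtain y where "poly [:\<gamma>, \<beta>, \<alpha>, 1:] y = 0"
        using odd_degree_has_real_root[of "[:\<gamma>, \<beta>, \<alpha>, 1:]"] by auto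
      then have y: "y ^ 3 + \<alpha> * y ^ 2 + \<beta> * y + \<gamma> = 0"
        by (simp add: algebra_simps power_numeral_reduce)
      have "m = (- x - y) + (\<alpha> + y)" "n = x * y + (- x - y) * (\<alpha> + y) + (\<beta> + (\<alpha> + y) * y)"
        by (auto simp: \<alpha>_def \<beta>_def algebra_simps)
      moreover have "k = (- x - y) * (\<beta> + (\<alpha> + y) * y) + x * y * (\<alpha> + y)"
        using y unfolding \<gamma>_def by algebra
      moreover have "l = x * y * (\<beta> + (\<alpha> + y) * y)"
        using x y unfolding \<alpha>_def \<beta>_def \<gamma>_def by algebra
      ultimately show ?thesis by blast
    next
      case False
      define b c where "b = - 2 * Re z" and "c = (Re z)\<^sup>2 + (Im z)\<^sup>2"
      define d where "d = m - b"
      define e where "e = n - c - b * d"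
      have zq: "z ^ 2 + b * z + c = 0"
        by (simp add: complex_eq_iff b_def c_def power2_eq_square)
      have "(z ^ 2 + b * z + c) * (z ^ 2 + d * z + e) + ((k - b * e - c * d) * z + (l - c * e)) = z ^ 4 + m * z ^ 3 + n * z ^ 2 + k * z + l"
        by (simp add: d_def e_def algebra_simps power_numeral_reduce)
      then have "of_real (k - b * e - c * d) * z + of_real (l - c * e) = 0"
        using z zq by simp
      then have "k - b * e - c * d = 0 \<and> l - c * e = 0"
        using False by (auto simp: complex_eq_iff)
      then show ?thesis by (intro exI[of _ b] exI[of _ c] exI[of _ d] exI[of _ e]) (auto simp: d_def e_def)
    qed
  qed
  then show thesis using that by (auto simp: algebra_simps)
qed

lemma real_quintic_factors:
  fixes a1 a2 a3 a4 a5 :: real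
  obtains r b c d e where "[:a5, a4, a3, a2, a1, 1:] = [:r, 1:] * ([:c, b, 1:] * [:e, d, 1:])"
proof -
  obtain x where "poly [:a5, a4, a3, a2, a1, 1:] x = 0"
    using odd_degree_has_real_root[of "[:a5, a4, a3, a2, a1, 1:]"] by auto
  define m where "m = a1 + x"
  define n where "n = a2 + m * x"
  define k where "k = a3 + n * x"
  define l where "l = a4 + k * x"
  have "[:a5, a4, a3, a2, a1, 1:] = [:- x, 1:] * [:l, k, n, m, 1:]"
    using \<open>poly _ x = 0\<close> by (simp add: m_def n_def k_def l_def algebra_simps)
  then show thesis using that real_quartic_quadratic_factors by metis
qed

section \<open>The Hurwitz criterion in degree five\<close>

lemma hurwitz_stable_mult:
  "hurwitz_stable (p * q) \<longleftrightarrow> hurwitz_stable p \<and> hurwitz_stable q"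
proof -
  have "map_poly complex_of_real (p * q) = map_poly complex_of_real p * map_poly complex_of_real q"
    by (rule poly_eqI) (simp add: coeff_map_poly coeff_mult)
  then show ?thesis by (auto simp: hurwitz_stable_def)
qed

lemma hurwitz_stable_linear: "hurwitz_stable [:r, 1:] \<longleftrightarrow> r > 0"
proof -
  have "of_real r + z = 0 \<longleftrightarrow> z = - complex_of_real r" for z
    by (metis add.commute eq_neg_iff_add_eq_0)
  then show ?thesis by (simp add: hurwitz_stable_def map_poly_pCons)
qed

lemma hurwitz_stable_quadratic: "hurwitz_stable [:c, b, 1:] \<longleftrightarrow> b > 0 \<and> c > 0"
proof -
  have poly: "poly (map_poly complex_of_real [:c, b, 1:]) z = z\<^sup>2 + b * z + c" for z :: complex
    by (simp add: map_poly_pCons power2_eq_square algebra_simps)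
  show ?thesis
  proof
    assume st: "hurwitz_stable [:c, b, 1:]"
    \<comment> \<open>The principal square root has nonnegative real part, so \<open>(s - b) / 2\<close> is the rightmost root.\<close>
    define s where "s = csqrt (of_real (b\<^sup>2 - 4 * c))"
    have s2: "s\<^sup>2 = of_real (b\<^sup>2 - 4 * c)" by (simp add: s_def)
    have "((s - b) / 2)\<^sup>2 + b * ((s - b) / 2) + c = (s\<^sup>2 - (of_real (b\<^sup>2 - 4 * c))) / 4"
      by (simp add: power2_eq_square field_simps)
    then have "poly (map_poly complex_of_real [:c, b, 1:]) ((s - b) / 2) = 0"
      by (simp add: poly s2)
    then have less: "Re s < b" using st by (auto simp: hurwitz_stable_def)
    moreover have "Re s \<ge> 0" unfolding s_def by (rule Re_csqrt)
    ultimately have b: "b > 0" by simp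
    have "c > 0"
    proof (rule ccontr)
      assume "\<not> c > 0"
      then have "b\<^sup>2 \<le> b\<^sup>2 - 4 * c" by simp
      then have "b \<le> sqrt (b\<^sup>2 - 4 * c)" using b real_le_rsqrt by blast
      moreover have "b\<^sup>2 - 4 * c \<ge> 0"
        using \<open>b\<^sup>2 \<le> b\<^sup>2 - 4 * c\<close> zero_le_power2 order_trans by blast
      then have "s = of_real (sqrt (b\<^sup>2 - 4 * c))"
        unfolding s_def by (rule csqrt_of_real)
      ultimately show False using less by simp
    qed
    with b show "b > 0 \<and> c > 0" ..
  next
    assume bc: "b > 0 \<and> c > 0"
    have "Re z < 0" if z: "z\<^sup>2 + b * z + c = 0" for z :: complex
    proof -
      have re: "(Re z)\<^sup>2 - (Im z)\<^sup>2 + b * Re z + c = 0"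
        and im: "Im z * (2 * Re z + b) = 0"
        using z by (auto simp: complex_eq_iff power2_eq_square algebra_simps)
      show ?thesis
      proof (cases "Im z = 0")
        case True
        then show ?thesis using re bc
          by (smt (verit) mult_nonneg_nonneg power2_less_0 zero_power2)
      next
        case False
        then show ?thesis using im bc by auto
      qed
    qed
    then show "hurwitz_stable [:c, b, 1:]" by (auto simp: hurwitz_stable_def poly)
  qed
qed

text \<open>
  Let \<open>q = x\<^sup>4 + m x\<^sup>3 + n x\<^sup>2 + k x + l\<close> be the product of the two quadratic factors. The fourth
  minor of the quintic is \<open>q(r) D\<close> with \<open>D\<close> the third minor of \<open>q\<close>; the value \<open>q(r)\<close> is positive, and
  \<open>D = b d ((c - e)\<^sup>2 + m k)\<close>. A stable quintic has positive parameters, hence positive minors.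
  Conversely, \<open>D > 0\<close> forces \<open>m n k > 0\<close>. Positivity of the coefficients and of the second minor
  leaves only \<open>m, k > 0\<close>; then \<open>b d > 0\<close> and \<open>b + d > 0\<close>, which yields stability.
\<close>

lemma hurwitz_criterion_quintic:
  fixes a1 a2 a3 a4 a5 :: real
  assumes pos: "a1 > 0" "a2 > 0" "a3 > 0" "a4 > 0" "a5 > 0"
  shows "hurwitz_stable [:a5, a4, a3, a2, a1, 1:] \<longleftrightarrow>
    a3 < a1 * a2 \<and> (a1 * a4 - a5)\<^sup>2 < (a1 * a2 - a3) * (a3 * a4 - a2 * a5)"
proof -
  obtain r b c d e where
    fac: "[:a5, a4, a3, a2, a1, 1:] = [:r, 1:] * ([:c, b, 1:] * [:e, d, 1:])"
    using real_quintic_factors .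
  have stable: "hurwitz_stable [:a5, a4, a3, a2, a1, 1:] \<longleftrightarrow> r > 0 \<and> b > 0 \<and> c > 0 \<and> d > 0 \<and> e > 0"
    unfolding fac hurwitz_stable_mult hurwitz_stable_linear hurwitz_stable_quadratic by blast
  define m n k l where "m = b + d" and "n = c + b * d + e" and "k = b * e + c * d" and "l = c * e"
  note mnkl = m_def n_def k_def l_def
  have a: "a1 = r + m" "a2 = n + r * m" "a3 = k + r * n" "a4 = l + r * k" "a5 = r * l"
    using fac by (simp_all add: mnkl algebra_simps)
  define D where "D = m * n * k - k\<^sup>2 - m\<^sup>2 * l"
  define Q where "Q = r ^ 4 + m * r ^ 3 + n * r\<^sup>2 + k * r + l"
  have minor: "(a1 * a2 - a3) * (a3 * a4 - a2 * a5) - (a1 * a4 - a5)\<^sup>2 = Q * D"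
    unfolding a Q_def D_def by algebra
  have D: "D = b * d * ((c - e)\<^sup>2 + m * k)"
    unfolding D_def mnkl by algebra
  have value_pos: "x ^ 5 + a1 * x ^ 4 + a2 * x ^ 3 + a3 * x\<^sup>2 + a4 * x + a5 > 0" if "x \<ge> 0" for x
    using that pos by (intro add_nonneg_pos add_nonneg_nonneg mult_nonneg_nonneg) auto
  have r: "r > 0"
  proof (rule ccontr)
    assume "\<not> r > 0"
    moreover have "(- r) ^ 5 + a1 * (- r) ^ 4 + a2 * (- r) ^ 3 + a3 * (- r)\<^sup>2 + a4 * (- r) + a5 = 0"
      unfolding a by algebra
    ultimately show False using value_pos[of "- r"] by simp
  qed
  have "2 * r * Q = r ^ 5 + a1 * r ^ 4 + a2 * r ^ 3 + a3 * r\<^sup>2 + a4 * r + a5"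
    unfolding a Q_def by algebra
  then have "2 * r * Q > 0" using value_pos[of r] r by simp
  then have Q: "Q > 0" using r by (simp add: zero_less_mult_iff)
  have l: "l > 0" using a(5) pos r by (simp add: zero_less_mult_iff)
  have minor_pos: "(a1 * a4 - a5)\<^sup>2 < (a1 * a2 - a3) * (a3 * a4 - a2 * a5) \<longleftrightarrow> D > 0"
    using minor Q zero_less_mult_pos by (smt (verit) mult_pos_pos)
  have minor2: "a1 * a2 - a3 = r * m * a1 + (m * n - k)"
    unfolding a by algebra
  show ?thesis
  proof
    assume "hurwitz_stable [:a5, a4, a3, a2, a1, 1:]"
    then have p: "b > 0" "c > 0" "d > 0" "e > 0" by (auto simp: stable)
    then have mk: "m > 0" "k > 0" by (auto simp: mnkl intro: add_pos_pos)
    have "m * n - k = b * c + d * e + b * d * m"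
      unfolding mnkl by algebra
    also have "\<dots> > 0" using p mk by (intro add_pos_pos) auto
    finally have "a3 < a1 * a2" using minor2 r mk pos by (smt (verit) mult_pos_pos)
    moreover have "D > 0"
      unfolding D using p mk by (intro mult_pos_pos add_nonneg_pos) auto
    ultimately show "a3 < a1 * a2 \<and> (a1 * a4 - a5)\<^sup>2 < (a1 * a2 - a3) * (a3 * a4 - a2 * a5)"
      using minor_pos by blast
  next
    assume "a3 < a1 * a2 \<and> (a1 * a4 - a5)\<^sup>2 < (a1 * a2 - a3) * (a3 * a4 - a2 * a5)"
    then have D2: "a1 * a2 - a3 > 0" and Dpos: "D > 0" using minor_pos by auto
    have "m\<^sup>2 * l \<ge> 0" using l by simp
    have "k \<noteq> 0" using Dpos \<open>m\<^sup>2 * l \<ge> 0\<close> by (auto simp: D_def)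
    then have "k\<^sup>2 > 0" by simp
    have mnk: "m * n * k > k\<^sup>2" using Dpos \<open>m\<^sup>2 * l \<ge> 0\<close> by (simp add: D_def)
    then have "m * n * k > 0" using \<open>k\<^sup>2 > 0\<close> by linarith
    consider "m > 0" "k > 0" | "m < 0" "k < 0" "n > 0" | "m < 0" "n < 0" | "k < 0" "n < 0"
      using \<open>m * n * k > 0\<close> by (auto simp: zero_less_mult_iff mult_less_0_iff)
    then have mk: "m > 0 \<and> k > 0"
    proof cases
      \<comment> \<open>Here \<open>D > 0\<close> gives \<open>m n < k\<close>, which makes the second minor negative.\<close>
      case 2
      have "(m * n) * k > k * k" using mnk by (simp add: power2_eq_square)
      then have "m * n < k" using \<open>k < 0\<close> by (simp add: mult_less_cancel_right)
      moreover have "r * m * a1 < 0" using r pos \<open>m < 0\<close> by (simp add: mult_less_0_iff zero_less_mult_iff)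
      ultimately show ?thesis using D2 minor2 by linarith
    next
      case 3
      then have "r * m < 0" using r by (simp add: mult_less_0_iff)
      then show ?thesis using a(2) pos 3 by linarith
    next
      case 4
      then have "r * n < 0" using r by (simp add: mult_less_0_iff)
      then show ?thesis using a(3) pos 4 by linarith
    qed simp
    then have "(c - e)\<^sup>2 + m * k > 0" by (simp add: add_nonneg_pos)
    then have "b * d > 0" using Dpos unfolding D by (simp add: zero_less_mult_iff)
    then have bd: "b > 0 \<and> d > 0" using mk by (auto simp: m_def zero_less_mult_iff)
    have "c > 0 \<and> e > 0"
    proof (rule ccontr)
      assume "\<not> (c > 0 \<and> e > 0)"
      then have "c < 0" "e < 0" using l by (auto simp: l_def zero_less_mult_iff)
      then have "b * e < 0" "c * d < 0" using bd by (auto simp: mult_less_0_iff)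
      then show False using mk by (simp add: k_def)
    qed
    then show "hurwitz_stable [:a5, a4, a3, a2, a1, 1:]" using r bd stable by blast
  qed
qed

lemma quintic_in_H5_iff:
  "[:a5, a4, a3, a2, a1, 1:] \<in> H5 \<longleftrightarrow>
    a1 > 0 \<and> a2 > 0 \<and> a3 > 0 \<and> a4 > 0 \<and> a5 > 0 \<and> hurwitz_stable [:a5, a4, a3, a2, a1, 1:]"
proof -
  have "(\<forall>i\<le>5. coeff [:a5, a4, a3, a2, a1, 1:] i > 0) \<longleftrightarrow>
      a1 > 0 \<and> a2 > 0 \<and> a3 > 0 \<and> a4 > 0 \<and> a5 > (0::real)"
    by (auto simp: numeral_eq_Suc le_Suc_eq all_conj_distrib)
  then show ?thesis by (auto simp: H5_def)
qed

text \<open>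
  The three differences in the Hurwitz minors become \<open>1 - u\<close>, \<open>1 - v\<close> and \<open>1 - u v\<close> after division by
  \<open>a1 a2\<close>, \<open>a3 a4\<close> and \<open>a1 a4\<close>, and \<open>w\<close> compensates the different weights of the two sides.
  The bound \<open>v < 1\<close> follows from \<open>u < 1\<close> since the product \<open>(1 - u) * (1 - v)\<close> has to be positive.
\<close>

lemma H5_iff_ratios:
  fixes a1 a2 a3 a4 a5 :: real
  assumes pos: "a1 > 0" "a2 > 0" "a3 > 0" "a4 > 0" "a5 > 0"
    and u: "u = a3 / (a1 * a2)" and v: "v = (a2 * a5) / (a3 * a4)" and w: "w = (a1 * a4) / (a2 * a3)"
  shows "[:a5, a4, a3, a2, a1, 1:] \<in> H5 \<longleftrightarrow>
    u < 1 \<and> v < 1 \<and> w * (1 - u * v)\<^sup>2 < (1 - u) * (1 - v)"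
proof -
  have "a1 * a2 - a3 = a1 * a2 * (1 - u)" using pos by (simp add: u field_simps)
  moreover have "a3 * a4 - a2 * a5 = a3 * a4 * (1 - v)" using pos by (simp add: v field_simps)
  moreover have "a1 * a4 - a5 = a1 * a4 * (1 - u * v)" using pos by (simp add: u v field_simps)
  ultimately have
    "(a1 * a2 - a3) * (a3 * a4 - a2 * a5) = a1 * a2 * a3 * a4 * ((1 - u) * (1 - v))"
    "(a1 * a4 - a5)\<^sup>2 = a1 * a2 * a3 * a4 * (w * (1 - u * v)\<^sup>2)"
    using pos by (simp_all add: w power2_eq_square)
  then have "(a1 * a4 - a5)\<^sup>2 < (a1 * a2 - a3) * (a3 * a4 - a2 * a5) \<longleftrightarrow>
      w * (1 - u * v)\<^sup>2 < (1 - u) * (1 - v)"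
    using pos by simp
  moreover have "a3 < a1 * a2 \<longleftrightarrow> u < 1" using pos by (simp add: u field_simps)
  ultimately have H5: "[:a5, a4, a3, a2, a1, 1:] \<in> H5 \<longleftrightarrow> u < 1 \<and> w * (1 - u * v)\<^sup>2 < (1 - u) * (1 - v)"
    using pos by (simp add: quintic_in_H5_iff hurwitz_criterion_quintic)
  have "v < 1" if "u < 1" "w * (1 - u * v)\<^sup>2 < (1 - u) * (1 - v)"
  proof -
    have "w > 0" using pos by (simp add: w)
    then have "w * (1 - u * v)\<^sup>2 \<ge> 0" by simp
    then have "(1 - u) * (1 - v) > 0" using that(2) by linarith
    then show ?thesis using that(1) by (simp add: zero_less_mult_iff)
  qed
  with H5 show ?thesis by blast
qed

lemma hadamard_power_quintic:
  "hadamard_power [:a5, a4, a3, a2, a1, 1:] p =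
    [:a5 powr p, a4 powr p, a3 powr p, a2 powr p, a1 powr p, 1:]"
  by (simp add: hadamard_power_def map_poly_pCons)

section \<open>Monotonicity through convexity of powers\<close>

lemma powr_less_one_iff:
  fixes x p :: real
  assumes "x > 0" "p > 0"
  shows "x powr p < 1 \<longleftrightarrow> x < 1"
  using assms by (metis less_eq_real_def powr_less_cancel2 powr_less_mono2 powr_one_eq_one zero_less_one)

text \<open>
  This compares slopes of chords of the convex function \<open>z \<mapsto> z\<^sup>s\<close>: the chord over \<open>[y, 1]\<close> is at most
  as steep as the chord over \<open>[x, 1]\<close>. The statement is cleared of denominators.
\<close>

lemma powr_chord_mono:
  fixes x y s :: real
  assumes "0 < y" "y \<le> x" "x < 1" "s \<ge> 1"
  shows "(1 - x) * (1 - y powr s) \<le> (1 - y) * (1 - x powr s)"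
proof -
  define t where "t = (x - y) / (1 - y)"
  have t: "0 \<le> t" "t \<le> 1" and "t * (1 - y) = x - y"
    using assms by (auto simp: t_def)
  then have x: "x = (1 - t) * y + t" by (simp add: algebra_simps)
  have "x powr s \<le> (1 - t) * y powr s + t * 1 powr s"
    using convex_onD[OF powr_convex[OF assms(4)], of t y 1] t assms(1) by (simp add: x)
  then have "(1 - t) * (1 - y powr s) \<le> 1 - x powr s" by (simp add: algebra_simps)
  then have "(1 - y) * ((1 - t) * (1 - y powr s)) \<le> (1 - y) * (1 - x powr s)"
    using assms by (intro mult_left_mono) auto
  moreover have "(1 - y) * (1 - t) = 1 - x" using assms by (simp add: t_def field_simps)
  ultimately show ?thesis by (metis mult.assoc)
qed

text \<open>
  With \<open>x = u\<^sup>p\<close>, \<open>y = (u v)\<^sup>p\<close> and \<open>s = q / p\<close>, passing from exponent \<open>p\<close> to \<open>q\<close> raises \<open>x\<close> and \<open>y\<close> to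
  the power \<open>s\<close>, so the claim is the logarithm of the chord inequality.
\<close>

lemma ln_one_minus_powr_diff_mono:
  fixes u v p q :: real
  assumes "0 < u" "u < 1" "0 < v" "v < 1" "0 < p" "p \<le> q"
  shows "ln (1 - u powr p) - ln (1 - (u * v) powr p) \<le> ln (1 - u powr q) - ln (1 - (u * v) powr q)"
proof -
  define x y s where "x = u powr p" and "y = (u * v) powr p" and "s = q / p"
  have uv: "0 < u * v" "u * v \<le> u" using assms by (auto intro: mult_pos_pos)
  then have y: "0 < y" "y \<le> x" and x: "x < 1"
    using assms by (auto simp: x_def y_def powr_less_one_iff intro!: powr_mono2)
  have s: "s \<ge> 1" using assms by (simp add: s_def)
  have xs: "u powr q = x powr s" and ys: "(u * v) powr q = y powr s"
    using assms by (simp_all add: x_def y_def s_def powr_powr)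
  have "x powr s < 1" "y powr s < 1"
    using x y s by (simp_all add: powr_less_one_iff)
  then have "ln ((1 - x) * (1 - y powr s)) \<le> ln ((1 - y) * (1 - x powr s))"
    using x y powr_chord_mono[OF y x s] by (subst ln_le_cancel_iff) auto
  then show ?thesis
    using x y s \<open>x powr s < 1\<close> \<open>y powr s < 1\<close>
    by (simp add: xs ys ln_mult flip: x_def y_def)
qed

section \<open>The sign of the threshold function\<close>

context
  fixes u v w :: real
  assumes u: "0 < u" "u < 1" and v: "0 < v" "v < 1" and w: "0 < w" "w < 1"
begin

lemma one_minus_powr_pos:
  assumes "p > 0"
  shows "1 - u powr p > 0" "1 - v powr p > 0" "1 - (u * v) powr p > 0"
proof -
  have "u * v < 1" using u v by (metis less_trans mult.right_neutral mult_strict_left_mono)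
  then show "1 - u powr p > 0" "1 - v powr p > 0" "1 - (u * v) powr p > 0"
    using assms u v by (simp_all add: powr_less_one_iff)
qed

lemma h_fun_strict_mono:
  assumes "0 < p" "p < q"
  shows "h_fun u v w p < h_fun u v w q"
proof -
  have "p * (- ln w) < q * (- ln w)" using w assms by (intro mult_strict_right_mono) auto
  then show ?thesis
    using ln_one_minus_powr_diff_mono[OF u v, of p q] ln_one_minus_powr_diff_mono[OF v u, of p q] assms
    by (simp add: h_fun_def mult.commute)
qed

lemma h_fun_eq_ln_diff:
  assumes "p > 0"
  shows "h_fun u v w p = ln ((1 - u powr p) * (1 - v powr p)) - ln (w powr p * (1 - (u * v) powr p)\<^sup>2)"
  using one_minus_powr_pos[OF assms] w
  by (simp add: h_fun_def ln_mult ln_realpow ln_powr)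

lemma h_fun_pos_iff:
  assumes "p > 0"
  shows "h_fun u v w p > 0 \<longleftrightarrow> w powr p * (1 - (u * v) powr p)\<^sup>2 < (1 - u powr p) * (1 - v powr p)"
  using one_minus_powr_pos[OF assms] w by (simp add: h_fun_eq_ln_diff[OF assms])

lemma h_fun_zero_iff:
  assumes "p > 0"
  shows "h_fun u v w p = 0 \<longleftrightarrow> (1 - u powr p) * (1 - v powr p) = w powr p * (1 - (u * v) powr p)\<^sup>2"
  using one_minus_powr_pos[OF assms] w by (simp add: h_fun_eq_ln_diff[OF assms])

text \<open>
  For \<open>x, y\<close> in \<open>(0,1)\<close>, writing \<open>1 - x y = (1 - x) + x (1 - y)\<close> and applying the
  arithmetic-geometric mean inequality gives \<open>4 x (1 - x) (1 - y) \<le> (1 - x y)\<^sup>2\<close>. With \<open>x = u\<^sup>p\<close>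
  and \<open>y = v\<^sup>p\<close> this bounds \<open>h_fun u v w p\<close> by \<open>- ln 4 - p * ln (u * w)\<close>, which is negative
  for small \<open>p\<close>.
\<close>

lemma h_fun_neg_near_zero:
  obtains p where "0 < p" "p < 1" "h_fun u v w p < 0"
proof -
  define L where "L = - ln u - ln w"
  have "ln u < 0" "ln w < 0" using u w by simp_all
  then have L: "L > 0" by (simp add: L_def)
  define p where "p = min (1/2) (ln 4 / (2 * L))"
  have p: "0 < p" "p < 1" using L by (auto simp: p_def)
  define x y where "x = u powr p" and "y = v powr p"
  have x: "0 < x" "0 < 1 - x" and y: "0 < 1 - y" and xy: "0 < 1 - x * y"
    using one_minus_powr_pos[OF p(1)] u v by (auto simp: x_def y_def powr_mult)
  have "4 * x * ((1 - x) * (1 - y)) \<le> (1 - x * y)\<^sup>2"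
  proof -
    have "(1 - x * y)\<^sup>2 - 4 * x * ((1 - x) * (1 - y)) = ((1 - x) - x * (1 - y))\<^sup>2" by algebra
    then show ?thesis by (metis diff_ge_0_iff_ge zero_le_power2)
  qed
  then have "ln (4 * x * ((1 - x) * (1 - y))) \<le> ln ((1 - x * y)\<^sup>2)"
    using x y xy by (subst ln_le_cancel_iff) auto
  then have "ln 4 + p * ln u + (ln (1 - x) + ln (1 - y)) \<le> 2 * ln (1 - x * y)"
    using x y xy u by (simp add: ln_mult ln_realpow) (simp add: x_def ln_powr)
  then have "h_fun u v w p \<le> p * L - ln 4"
    using u v by (simp add: h_fun_def L_def x_def y_def powr_mult algebra_simps)
  moreover have "p * L \<le> ln 4 / (2 * L) * L" using L by (intro mult_right_mono) (auto simp: p_def)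
  then have "2 * (p * L) \<le> ln 4" using L by simp
  moreover have "ln (4::real) > 0" by simp
  ultimately have "h_fun u v w p < 0" by linarith
  then show thesis using p that by blast
qed

lemma h_fun_continuous: "continuous_on {0<..} (h_fun u v w)"
  unfolding h_fun_def using u v one_minus_powr_pos
  by (intro continuous_intros) (auto simp: less_imp_neq[symmetric])

lemma h_fun_unique_zero:
  assumes "h_fun u v w 1 > 0"
  obtains z where "0 < z" "z < 1"
    "\<And>p. p > 0 \<Longrightarrow> h_fun u v w p = 0 \<longleftrightarrow> p = z"
    "\<And>p. p > 0 \<Longrightarrow> h_fun u v w p > 0 \<longleftrightarrow> z < p"
proof -
  obtain p where p: "0 < p" "p < 1" "h_fun u v w p < 0" using h_fun_neg_near_zero .
  have "continuous_on {p..1} (h_fun u v w)"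
    using p by (intro continuous_on_subset[OF h_fun_continuous]) auto
  then obtain z where z: "p \<le> z" "z \<le> 1" "h_fun u v w z = 0"
    using IVT'[of "h_fun u v w" p 0 1] p assms by auto
  have "z \<noteq> 1" using z assms by auto
  show thesis
  proof (rule that[of z])
    fix q :: real assume "q > 0"
    then show "h_fun u v w q = 0 \<longleftrightarrow> q = z" "h_fun u v w q > 0 \<longleftrightarrow> z < q"
      using h_fun_strict_mono[of q z] h_fun_strict_mono[of z q] z p
      by (cases q z rule: linorder_cases; force)+
  qed (use z p \<open>z \<noteq> 1\<close> in auto)
qed

end

section \<open>The stability threshold of Hadamard powers\<close>

theorem theorem2p3:
  fixes a1 a2 a3 a4 a5 u v w :: real and f :: "real poly"
  assumes f_def: "f = [:a5, a4, a3, a2, a1, 1:]"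
    and f_H5: "f \<in> H5"
    and u_def: "u = a3 / (a1 * a2)"
    and v_def: "v = (a2 * a5) / (a3 * a4)"
    and w_def: "w = (a1 * a4) / (a2 * a3)"
  shows "\<exists>pstar::real. 0 < pstar \<and> pstar < 1
    \<and> {p. p > 0 \<and> h_fun u v w p = 0} = {pstar}
    \<and> stable_powers f = {pstar<..}
    \<and> {p. 0 < p \<and> p < 1 \<and>
          (1 - u powr p) * (1 - v powr p) = w powr p * (1 - (u * v) powr p)\<^sup>2} = {pstar}"
proof -
  have pos: "a1 > 0" "a2 > 0" "a3 > 0" "a4 > 0" "a5 > 0"
    using f_H5 by (auto simp: f_def quintic_in_H5_iff)
  have uvw_pos: "u > 0" "v > 0" "w > 0" using pos by (simp_all add: u_def v_def w_def)
  have stable: "u < 1" "v < 1" "w * (1 - u * v)\<^sup>2 < (1 - u) * (1 - v)"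
    using f_H5 H5_iff_ratios[OF pos u_def v_def w_def] by (auto simp: f_def)
  \<comment> \<open>Both \<open>1 - u\<close> and \<open>1 - v\<close> are at most \<open>1 - u v\<close>, so the stability inequality bounds \<open>w\<close>.\<close>
  have "w < 1"
  proof -
    have "u * v \<le> u" "u * v \<le> v" using stable uvw_pos by auto
    then have "(1 - u) * (1 - v) \<le> (1 - u * v)\<^sup>2"
      unfolding power2_eq_square using stable by (intro mult_mono) auto
    then have "w * (1 - u * v)\<^sup>2 < 1 * (1 - u * v)\<^sup>2" using stable by linarith
    then show ?thesis by (rule mult_right_less_imp_less) simp
  qed
  note uvw = uvw_pos(1) stable(1) uvw_pos(2) stable(2) uvw_pos(3) \<open>w < 1\<close>
  have "h_fun u v w 1 > 0"
    using stable uvw by (simp add: h_fun_pos_iff[OF uvw])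
  then obtain z where z: "0 < z" "z < 1"
    and zero: "\<And>p. p > 0 \<Longrightarrow> h_fun u v w p = 0 \<longleftrightarrow> p = z"
    and gt: "\<And>p. p > 0 \<Longrightarrow> h_fun u v w p > 0 \<longleftrightarrow> z < p"
    using h_fun_unique_zero[OF uvw] by metis
  have "hadamard_power f p \<in> H5 \<longleftrightarrow> h_fun u v w p > 0" if "p > 0" for p
  proof -
    have "hadamard_power f p \<in> H5 \<longleftrightarrow> u powr p < 1 \<and> v powr p < 1 \<and>
        w powr p * (1 - u powr p * v powr p)\<^sup>2 < (1 - u powr p) * (1 - v powr p)"
      unfolding f_def hadamard_power_quintic using pos
      by (intro H5_iff_ratios) (simp_all add: u_def v_def w_def powr_mult powr_divide)
    then show ?thesis
      using that uvw by (simp add: h_fun_pos_iff[OF uvw] powr_less_one_iff powr_mult)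
  qed
  then have "stable_powers f = {z<..}"
    using gt z by (auto simp: stable_powers_def)
  moreover have "{p. p > 0 \<and> h_fun u v w p = 0} = {z}" using zero z by auto
  moreover have "{p. 0 < p \<and> p < 1 \<and>
      (1 - u powr p) * (1 - v powr p) = w powr p * (1 - (u * v) powr p)\<^sup>2} = {z}"
    using zero z by (auto simp flip: h_fun_zero_iff[OF uvw])
  ultimately show ?thesis using z by blast
qed

end
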